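(* In the setting of the context (graph assumptions (G1)-(G2), loss assumptions (L1)-(L2), and the distributed zeroth-order CVaR iteration), let $\bar x_k=\frac1m\sum_{i=1}^mx_k^i$. If $\sum_{k=0}^\infty\eta_k=\infty$ and $\sum_{k=0}^\infty\eta_k^2<\infty$, then $\sum_{k=0}^\infty\eta_k\|\bar x_k-x_k^i\|<\infty$ for all $i\in\mathcal V$. Furthermore, for all $i\in\mathcal V$, $\lim_{k\to\infty}\|\bar x_{k+1}-x_{k+1}^i\|=0$ almost surely.
   Context: Problem. Let $m,d\ge1$ be integers, $\mathcal V=[m]=\{1,\dots,m\}$, $\|\cdot\|$ the Euclidean norm on $\mathbb R^d$, $\mathbb B$ the closed unit ball and $\mathbb S^{d-1}$ the unit sphere. $\mathcal X\subset\mathbb R^d$ is nonempty, compact and convex, and $r\mathbb B\subseteq\mathcal X$ for some $r>0$. For each agent $i\in[m]$: $P_i$ is a probability distribution on $\Xi_i$, $J^i:\mathcal X\times\Xi_i\to\mathbb R$ is a loss ($J^i(x,\xi^i)$ is a real random variable for $\xi^i\sim P_i$), and $\alpha_i\in(0,1)$ is a risk level. Write $(z)_+=\max\{z,0\}$. Loss assumptions. (L1) For every $i$ and $\xi^i\in\Xi_i$, $J^i(\cdot,\xi^i)$ is $L_i$-Lipschitz on $\mathcal X$, and $|J^i(x,\xi^i)|\le U_i$ for all $(x,\xi^i)$, with $U_i>0$. (L2) For every $i$ and $\xi^i\in\Xi_i$, $J^i(\cdot,\xi^i)$ is convex on $\mathcal X$. Graph assumptions. $\mathcal G_k=(\mathcal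 V,\mathcal E_k)$, $k\ge0$, is a deterministic sequence of undirected graphs; $\mathcal N_k^i$ consists of $i$ and its neighbors in $\mathcal G_k$. (G1) There is an integer $q\ge1$ such that $(\mathcal V,\bigcup_{l=1}^q\mathcal E_{k+l})$ is connected for all $k$. (G2) For every $k\ge0$ the weight matrix $W_k=[w_k^{ij}]$ is doubly stochastic, $w_k^{ij}=0$ whenever $j\notin\mathcal N_k^i$, $w_k^{ii}>0$ for all $i$, and there is $\varrho>0$ (independent of $k$) with $w_k^{ij}\ge\varrho$ for all $i\in\mathcal V$, $j\in\mathcal N_k^i$. Algorithm. Smoothing radii $\delta_i>0$, $\delta_{\max}=\max_i\delta_i<r$; $\mathcal X_\delta=\{x: x/(1-\delta_{\max}/r)\in\mathcal X\}$; $\mathcal P_{\mathcal X_\delta}$ is Euclidean projection onto $\mathcal X_\delta$; step sizes $\eta_k>0$; sample sizes $s_k^i\ge1$ (integers); initial points $x_0^i\in\mathcal X_\delta$. For $k\ge0$ and $i\in[m]$: $y_k^i=\sum_{j\in\mathcal N_k^i}w_k^{ij}x_k^j$; $\hat y_k^i=y_k^i+\delta_iu_k^i$ with $u_k^i\sim\mathrm{Unif}(\mathbb S^{d-1})$ (this lies in $\mathcal X$); $\widehat C_k^i(\hat y_k^i)=\min_{\tau\in\mathbb R}\{\tau+\frac1{\alpha_is_k^i}\sum_{j=1}^{s_k^i}(J^i(\hat y_k^i,\xi_k^{i,j})-\tau)_+\}$; $\hat g_k^i=\frac d{\delta_i}\widehat C_k^i(\hat y_k^i)u_k^i$; $x_{k+1}^i=\mathcal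 P_{\mathcal X_\delta}[y_k^i-\eta_k\hat g_k^i]$. Randomness. For each $i$ the samples $\{\xi_k^{i,j}\}_{k,j}$ are i.i.d. from $P_i$ and independent of the perturbation directions and past iterates; given the history up to iteration $k$, the $u_k^1,\dots,u_k^m$ are independent and uniform on $\mathbb S^{d-1}$. *)

theory Defs
  imports "Graph_Theory.Digraph_Component" "HOL-Probability.Probability"
begin

definition doubly_stochastic :: "nat \<Rightarrow> (nat \<Rightarrow> nat \<Rightarrow> real) \<Rightarrow> bool" where
  "doubly_stochastic m A \<longleftrightarrow>
     (\<forall>i\<in>{1..m}. \<forall>j\<in>{1..m}. 0 \<le> A i j) \<and>
     (\<forall>i\<in>{1..m}. (\<Sum>j\<in>{1..m}. A i j) = 1) \<and>
     (\<forall>j\<in>{1..m}. (\<Sum>i\<in>{1..m}. A i j) = 1)"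

text \<open>An undirected graph is represented by its symmetric arc relation.\<close>

definition graph_on :: "nat \<Rightarrow> (nat \<times> nat) set \<Rightarrow> nat pair_pre_digraph" where
  "graph_on m E = \<lparr>pverts = {1..m}, parcs = E\<rparr>"

definition nbhd :: "(nat \<times> nat) set \<Rightarrow> nat \<Rightarrow> nat set" where
  "nbhd E i = insert i {j. (i, j) \<in> E}"

definition shrink :: "real \<Rightarrow> (real ^ 'd) set \<Rightarrow> (real ^ 'd) set" where
  "shrink c X = {x. x /\<^sub>R (1 - c) \<in> X}"

definition cvar_objective :: "real \<Rightarrow> nat \<Rightarrow> (nat \<Rightarrow> real) \<Rightarrow> real \<Rightarrow> real" where
  "cvar_objective \<alpha> n z \<tau> = \<tau> + 1 / (\<alpha> * real n) * (\<Sum>j=1..n. max (z j - \<tau>) 0)"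

text \<open>The infimum is a minimum for the parameters of interest: \<open>empirical_cvar_attained\<close>.\<close>

definition empirical_cvar :: "real \<Rightarrow> nat \<Rightarrow> (nat \<Rightarrow> real) \<Rightarrow> real" where
  "empirical_cvar \<alpha> n z = (INF \<tau>. cvar_objective \<alpha> n z \<tau>)"

lemma empirical_cvar_attained:
  assumes \<alpha>: "0 < \<alpha>" "\<alpha> < 1" and n: "1 \<le> n"
  shows "\<exists>\<tau>. empirical_cvar \<alpha> n z = cvar_objective \<alpha> n z \<tau>
           \<and> (\<forall>\<tau>'. cvar_objective \<alpha> n z \<tau> \<le> cvar_objective \<alpha> n z \<tau>')"
proof -
  let ?f = "cvar_objective \<alpha> n z"
  define B where "B = (\<Sum>j=1..n. \<bar>z j\<bar>)"
  have zB: "\<bar>z j\<bar> \<le> B" if "j \<in> {1..n}" for j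
    unfolding B_def using that by (intro member_le_sum) auto
  have B0: "0 \<le> B" unfolding B_def by (simp add: sum_nonneg)
  have c: "1 / (\<alpha> * real n) * real n = 1 / \<alpha>" using \<alpha> n by (simp add: field_simps)
  have "continuous_on {-B..B} ?f"
    unfolding cvar_objective_def by (intro continuous_intros)
  then obtain t where t: "t \<in> {-B..B}" "\<And>y. y \<in> {-B..B} \<Longrightarrow> ?f t \<le> ?f y"
    using continuous_attains_inf[of "{-B..B}" ?f] B0 by auto
  have above: "?f B \<le> ?f y" if "B \<le> y" for y
  proof -
    have "(\<Sum>j=1..n. max (z j - B) 0) = 0"
      by (intro sum.neutral ballI) (use zB in \<open>force simp: max_def\<close>)
    moreover have "0 \<le> 1 / (\<alpha> * real n) * (\<Sum>j=1..n. max (z j - y) 0)"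
      using \<alpha> by (intro mult_nonneg_nonneg sum_nonneg) auto
    ultimately show ?thesis using that by (simp add: cvar_objective_def)
  qed
  have below: "?f (-B) \<le> ?f y" if "y \<le> -B" for y
  proof -
    have "(\<Sum>j=1..n. max (z j - y) 0) = (\<Sum>j=1..n. max (z j - (-B)) 0 + (-B - y))"
    proof (intro sum.cong refl)
      fix j assume "j \<in> {1..n}"
      then show "max (z j - y) 0 = max (z j - (-B)) 0 + (-B - y)"
        using zB[of j] that by (auto simp: max_def abs_le_iff)
    qed
    also have "\<dots> = (\<Sum>j=1..n. max (z j - (-B)) 0) + real n * (-B - y)"
      by (simp only: sum.distrib sum_constant card_atLeastAtMost) simp
    finally have "?f y = y + 1 / (\<alpha> * real n) * (\<Sum>j=1..n. max (z j - (-B)) 0)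
        + (1 / (\<alpha> * real n) * real n) * (-B - y)"
      unfolding cvar_objective_def by (simp only: distrib_left mult.assoc add.assoc)
    then have eq: "?f y = ?f (-B) + (1 / \<alpha> - 1) * (-B - y)"
      unfolding c cvar_objective_def by (simp add: algebra_simps)
    have "0 \<le> (1 / \<alpha> - 1) * (-B - y)"
      using \<alpha> that by (intro mult_nonneg_nonneg) (auto simp: field_simps)
    then show ?thesis using eq by linarith
  qed
  have min: "?f t \<le> ?f y" for y
  proof (cases "y \<in> {-B..B}")
    case False
    then consider "y \<le> -B" | "B \<le> y" by fastforce
    then show ?thesis
      using above below t(2)[of B] t(2)[of "-B"] B0
      by cases (auto intro: order_trans)
  qed (rule t(2))
  then have "empirical_cvar \<alpha> n z = ?f t"
    unfolding empirical_cvar_def by (intro cInf_eq_minimum) auto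
  with min show ?thesis by blast
qed

text \<open>
  The normalised surface measure of the unit sphere is the law of \<open>x / norm x\<close> for \<open>x\<close>
  uniform in the unit ball. In dimension one this is the uniform law on \<open>{-1, 1}\<close>.
\<close>

definition uniform_sphere :: "(real ^ 'd) measure" where
  "uniform_sphere = distr (uniform_measure lborel (ball 0 1)) borel (\<lambda>x. x /\<^sub>R norm x)"

lemma prob_space_uniform_sphere: "prob_space (uniform_sphere :: (real ^ 'd) measure)"
proof -
  have "unit_ball_vol (real CARD('d)) \<noteq> 0"
    by (rule less_imp_neq[THEN not_sym], rule unit_ball_vol_pos) simp
  then have "emeasure lborel (ball (0 :: real ^ 'd) 1) \<noteq> 0"
    by (simp add: emeasure_ball)
  moreover have "emeasure lborel (ball (0 :: real ^ 'd) 1) \<noteq> \<infinity>"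
    using emeasure_lborel_ball_finite[of "0 :: real ^ 'd" 1] by auto
  ultimately have "prob_space (uniform_measure lborel (ball (0 :: real ^ 'd) 1))"
    by (rule prob_space_uniform_measure)
  then show ?thesis
    unfolding uniform_sphere_def by (rule prob_space.prob_space_distr) measurable
qed

definition rv_events ::
    "'w measure \<Rightarrow> ('i \<Rightarrow> 'w \<Rightarrow> 'a) \<Rightarrow> ('i \<Rightarrow> 'a measure) \<Rightarrow> 'i set \<Rightarrow> 'w set set" where
  "rv_events M Y N I = {Y i -` A \<inter> space M | i A. i \<in> I \<and> A \<in> sets (N i)}"

text \<open>
  The history up to iteration \<open>k\<close> contains the iterates \<open>x 0, \<dots>, x k\<close>, but only the
  perturbation directions and samples drawn strictly before iteration \<open>k\<close>.
\<close>

definition history ::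
    "'w measure \<Rightarrow> nat \<Rightarrow> (nat \<Rightarrow> 'b measure) \<Rightarrow> (nat \<Rightarrow> nat \<Rightarrow> nat)
     \<Rightarrow> (nat \<Rightarrow> nat \<Rightarrow> 'w \<Rightarrow> real ^ 'd) \<Rightarrow> (nat \<Rightarrow> nat \<Rightarrow> 'w \<Rightarrow> real ^ 'd)
     \<Rightarrow> (nat \<Rightarrow> nat \<Rightarrow> nat \<Rightarrow> 'w \<Rightarrow> 'b) \<Rightarrow> nat \<Rightarrow> 'w measure" where
  "history M m P s x u \<xi> k = sigma (space M)
     (rv_events M (\<lambda>(l, i). x l i) (\<lambda>_. borel) ({..k} \<times> {1..m}) \<union>
      rv_events M (\<lambda>(l, i). u l i) (\<lambda>_. borel) ({..<k} \<times> {1..m}) \<union>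
      rv_events M (\<lambda>(l, i, j). \<xi> l i j) (\<lambda>(l, i, j). P i)
        {(l, i, j). l < k \<and> i \<in> {1..m} \<and> j \<in> {1..s l i}})"

end

theory Submission
  imports Defs
begin

text \<open>
  The statement holds on every sample path, since the perturbation of the averaging step by the
  projected gradient estimate is at most a constant times \<open>\<eta> k\<close>: the sampled losses
  bound the empirical CVaR. Over \<open>T = (q + 1) * m\<close> steps the product of the weight matrices has
  all entries at least \<open>\<rho> ^ T\<close>, because the set of agents reached from a given one grows in
  every window of \<open>q + 1\<close> steps. Hence the diameter \<open>D\<close> of the iterates satisfies
  \<open>D (k + T) \<le> c * D k + h k\<close> with \<open>c < 1\<close> and \<open>h\<close> square summable, so \<open>D\<close> is square
  summable. This gives the limit, and the summability of \<open>\<eta> k * D k\<close> by AM-GM.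
\<close>

section \<open>Bounds for the empirical CVaR\<close>

text \<open>For the upper bound, compare the minimiser with \<open>B\<close>, where every hinge term
  vanishes. For the lower bound only \<open>\<tau> < -B\<close> is critical: there each hinge term
  is at least \<open>-B - \<tau> > 0\<close>, and averaging with the factor
  \<open>1 / \<alpha>\<close>, which exceeds one, recovers what \<open>\<tau>\<close> lacks.\<close>

lemma bounded_empirical_cvar:
  assumes "0 < \<alpha>" "\<alpha> < 1" "1 \<le> n" and z: "\<And>j. j \<in> {1..n} \<Longrightarrow> \<bar>z j\<bar> \<le> B"
  shows "\<bar>empirical_cvar \<alpha> n z\<bar> \<le> B"
proof -
  obtain \<tau> where \<tau>: "empirical_cvar \<alpha> n z = cvar_objective \<alpha> n z \<tau>"
    and min: "\<And>\<tau>'. cvar_objective \<alpha> n z \<tau> \<le> cvar_objective \<alpha> n z \<tau>'"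
    using empirical_cvar_attained assms(1-3) by blast
  have "(\<Sum>j=1..n. max (z j - B) 0) = 0"
    by (intro sum.neutral ballI) (use z in \<open>force simp: max_def\<close>)
  then have "cvar_objective \<alpha> n z \<tau> \<le> B"
    using min[of B] by (simp add: cvar_objective_def)
  moreover have "-B \<le> cvar_objective \<alpha> n z \<tau>"
  proof (cases "-B \<le> \<tau>")
    case True
    have "0 \<le> 1 / (\<alpha> * real n) * (\<Sum>j=1..n. max (z j - \<tau>) 0)"
      using assms by (intro mult_nonneg_nonneg sum_nonneg) auto
    with True show ?thesis by (simp add: cvar_objective_def)
  next
    case False
    have "-B - \<tau> \<le> max (z j - \<tau>) 0" if "j \<in> {1..n}" for j
      using z[OF that] by linarith
    then have "(\<Sum>j=1..n. -B - \<tau>) \<le> (\<Sum>j=1..n. max (z j - \<tau>) 0)"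
      by (rule sum_mono)
    then have "real n * (-B - \<tau>) \<le> (\<Sum>j=1..n. max (z j - \<tau>) 0)"
      by simp
    then have "1 / (\<alpha> * real n) * (real n * (-B - \<tau>))
        \<le> 1 / (\<alpha> * real n) * (\<Sum>j=1..n. max (z j - \<tau>) 0)"
      using assms by (intro mult_left_mono) auto
    moreover have "1 / (\<alpha> * real n) * (real n * (-B - \<tau>)) = (-B - \<tau>) / \<alpha>"
      using assms by (simp add: field_simps)
    moreover have "\<alpha> * (-B - \<tau>) \<le> 1 * (-B - \<tau>)"
      using assms False by (intro mult_right_mono) auto
    then have "-B - \<tau> \<le> (-B - \<tau>) / \<alpha>"
      using assms by (simp add: le_divide_eq mult.commute)
    ultimately show ?thesis unfolding cvar_objective_def by linarith
  qed
  ultimately show ?thesis using \<tau> by linarith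
qed

section \<open>The shrunken feasible set\<close>

lemma shrink_eq_image:
  fixes X :: "(real ^ 'd) set"
  assumes "c < 1"
  shows "shrink c X = (\<lambda>z. (1 - c) *\<^sub>R z) ` X"
proof (intro set_eqI iffI)
  fix a assume "a \<in> shrink c X"
  then have "a /\<^sub>R (1 - c) \<in> X" "a = (1 - c) *\<^sub>R (a /\<^sub>R (1 - c))"
    using assms by (auto simp: shrink_def)
  then show "a \<in> (\<lambda>z. (1 - c) *\<^sub>R z) ` X" by blast
qed (use assms in \<open>auto simp: shrink_def\<close>)

text \<open>With \<open>c = b / r\<close> the sum is the convex combination of a point of
  \<open>X\<close> with weight \<open>1 - c\<close> and of \<open>v /\<^sub>R c\<close>, which lies
  in the ball of radius \<open>r\<close>, with weight \<open>c\<close>. This keeps the perturbed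
  query points feasible.\<close>

lemma add_mem_of_shrink:
  fixes X :: "(real ^ 'd) set"
  assumes "convex X" "0 < r" "cball 0 r \<subseteq> X" "0 < b" "b < r"
    and a: "a \<in> shrink (b / r) X" and v: "norm v \<le> b"
  shows "a + v \<in> X"
proof -
  define c where "c = b / r"
  have c: "0 < c" "c < 1" using assms by (auto simp: c_def)
  obtain z where z: "z \<in> X" "a = (1 - c) *\<^sub>R z"
    using a c by (auto simp: shrink_eq_image c_def[symmetric])
  have "norm (v /\<^sub>R c) \<le> r"
    using v c assms(2,4) by (simp add: c_def field_simps)
  then have "v /\<^sub>R c \<in> X" using assms(3) by auto
  then have "(1 - c) *\<^sub>R z + c *\<^sub>R (v /\<^sub>R c) \<in> X"
    using z c assms(1) by (intro convexD) auto
  then show ?thesis using z c by simp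
qed

section \<open>Connectivity across a cut\<close>

text \<open>A path from \<open>S\<close> to its complement must leave \<open>S\<close> along some
  arc. Symmetry turns that arc around, so that \<open>i\<close> is the agent outside
  \<open>S\<close> that listens to \<open>j\<close>, matching the index order of the
  weights.\<close>

lemma connected_graph_on_crossing:
  assumes conn: "Digraph_Component.connected (with_proj (graph_on m E))"
    and sub: "E \<subseteq> {1..m} \<times> {1..m}" and sym: "sym E"
    and S: "S \<subseteq> {1..m}" "S \<noteq> {}" "S \<noteq> {1..m}"
  obtains i j where "i \<in> {1..m} - S" "j \<in> S" "(i, j) \<in> E"
proof -
  \<comment> \<open>Connectedness is defined through the symmetric closure, which for a symmetric
    relation adds nothing.\<close>
  have par: "parcs (mk_symmetric (with_proj (graph_on m E))) = E"
    using sym by (auto simp: mk_symmetric_def graph_on_def arcs_ends_def arc_to_ends_def sym_def)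
  have ver: "pverts (mk_symmetric (with_proj (graph_on m E))) = {1..m}"
    by (simp add: mk_symmetric_def graph_on_def)
  obtain a b where ab: "a \<in> S" "b \<in> {1..m} - S" using S by blast
  have "a \<rightarrow>\<^sup>*\<^bsub>with_proj (mk_symmetric (with_proj (graph_on m E)))\<^esub> b"
    using conn ab S ver by (auto simp: connected_def strongly_connected_def)
  then have "(a, b) \<in> E\<^sup>*"
    by (auto simp: reachable_def par dest: rtrancl_on_rtranclI)
  then have "b \<in> S \<or> (\<exists>i j. i \<in> {1..m} - S \<and> j \<in> S \<and> (i, j) \<in> E)"
  proof (induction rule: rtrancl_induct)
    case base
    then show ?case using ab by blast
  next
    case (step y z)
    then have "(z, y) \<in> E" "z \<in> {1..m}" using sym sub by (auto dest: symD)
    then show ?case using step by blast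
  qed
  then show ?thesis using that ab by blast
qed

section \<open>Scalar recursions and inequalities\<close>

text \<open>Summing the recursion bounds a partial sum by the first \<open>T\<close> terms,
  \<open>suminf b\<close> and \<open>c\<close> times the same partial sum. As \<open>c < 1\<close>,
  the last term is absorbed on the left.\<close>

lemma summable_contractive_recursion:
  fixes a b :: "nat \<Rightarrow> real"
  assumes a: "\<And>k. 0 \<le> a k" and b: "\<And>k. 0 \<le> b k" "summable b" and c: "c < 1"
    and step: "\<And>k. a (k + T) \<le> c * a k + b k"
  shows "summable a"
proof (rule summableI_nonneg_bounded[OF a])
  fix N
  have "(\<Sum>k<N. a k) \<le> (\<Sum>k<T + N. a k)"
    using a by (intro sum_mono2) auto
  also have "\<dots> = (\<Sum>k<T. a k) + (\<Sum>k<N. a (k + T))"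
    by (induction N) (auto simp: add.commute)
  also have "(\<Sum>k<N. a (k + T)) \<le> c * (\<Sum>k<N. a k) + (\<Sum>k<N. b k)"
    unfolding sum_distrib_left sum.distrib[symmetric] by (intro sum_mono step)
  also have "(\<Sum>k<N. b k) \<le> suminf b"
    using b by (intro sum_le_suminf) auto
  finally have "(1 - c) * (\<Sum>k<N. a k) \<le> (\<Sum>k<T. a k) + suminf b"
    by (simp add: algebra_simps)
  then show "(\<Sum>k<N. a k) \<le> ((\<Sum>k<T. a k) + suminf b) / (1 - c)"
    using c by (simp add: field_simps)
qed

text \<open>Young's inequality, weighted so that the factor of the squared term is again
  \<open>c\<close>: a contraction of \<open>d\<close> thus yields one of its square. The gap between
  the two sides is a multiple of a perfect square.\<close>

lemma power2_add_le_contraction: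
  fixes d e :: real
  assumes "0 \<le> c" "c < 1"
  shows "(c * d + e)\<^sup>2 \<le> c * d\<^sup>2 + e\<^sup>2 / (1 - c)"
proof -
  have "c * d\<^sup>2 + e\<^sup>2 / (1 - c) - (c * d + e)\<^sup>2 = c / (1 - c) * ((1 - c) * d - e)\<^sup>2"
    using assms by (simp add: field_simps power2_eq_square)
  moreover have "0 \<le> c / (1 - c) * ((1 - c) * d - e)\<^sup>2" using assms by simp
  ultimately show ?thesis by linarith
qed

section \<open>Products of averaging matrices\<close>

text \<open>\<open>crossing\<close> is the cut form of connectivity over a window: no proper
  nonempty set of agents goes unheard by the others during \<open>q\<close> consecutive
  steps.\<close>

locale averaging_weights =
  fixes V :: "'v set" and w :: "nat \<Rightarrow> 'v \<Rightarrow> 'v \<Rightarrow> real" and \<rho> :: real and q :: nat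
  assumes finite_V: "finite V"
    and nonneg: "\<And>k i j. i \<in> V \<Longrightarrow> j \<in> V \<Longrightarrow> 0 \<le> w k i j"
    and row_sum: "\<And>k i. i \<in> V \<Longrightarrow> (\<Sum>j\<in>V. w k i j) = 1"
    and \<rho>_pos: "0 < \<rho>"
    and diag: "\<And>k i. i \<in> V \<Longrightarrow> \<rho> \<le> w k i i"
    and crossing: "\<And>k S. S \<subseteq> V \<Longrightarrow> S \<noteq> {} \<Longrightarrow> S \<noteq> V \<Longrightarrow>
      \<exists>h\<in>{1..q}. \<exists>i\<in>V - S. \<exists>j\<in>S. \<rho> \<le> w (k + h) i j"
begin

text \<open>The matrix product \<open>w (s + n - 1) ... w s\<close>, newest factor on the left; it
  is the identity for \<open>n = 0\<close>.\<close>

primrec transition :: "nat \<Rightarrow> nat \<Rightarrow> 'v \<Rightarrow> 'v \<Rightarrow> real" where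
  "transition s 0 = (\<lambda>i j. if i = j then 1 else 0)"
| "transition s (Suc n) = (\<lambda>i j. \<Sum>l\<in>V. w (s + n) i l * transition s n l j)"

lemma transition_nonneg: "i \<in> V \<Longrightarrow> j \<in> V \<Longrightarrow> 0 \<le> transition s n i j"
  by (induction n arbitrary: i) (auto intro!: sum_nonneg mult_nonneg_nonneg nonneg)

lemma transition_row_sum: "i \<in> V \<Longrightarrow> (\<Sum>j\<in>V. transition s n i j) = 1"
proof (induction n arbitrary: i)
  case 0
  then show ?case using finite_V by simp
next
  case (Suc n)
  have "(\<Sum>j\<in>V. transition s (Suc n) i j) = (\<Sum>l\<in>V. w (s + n) i l * (\<Sum>j\<in>V. transition s n l j))"
    by (simp add: sum_distrib_left) (rule sum.swap)
  also have "\<dots> = 1" using Suc row_sum by simp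
  finally show ?case .
qed

text \<open>The threshold \<open>\<rho> ^ n\<close> is the least weight that a chain of
  \<open>n\<close> links, each of weight at least \<open>\<rho>\<close>, can transmit from
  \<open>j\<close> to \<open>i\<close>.\<close>

definition reached :: "nat \<Rightarrow> nat \<Rightarrow> 'v \<Rightarrow> 'v set" where
  "reached s n j = {i \<in> V. \<rho> ^ n \<le> transition s n i j}"

lemma reached_Suc:
  assumes "l \<in> reached s n j" "i \<in> V" "j \<in> V" "\<rho> \<le> w (s + n) i l"
  shows "i \<in> reached s (Suc n) j"
proof -
  have l: "l \<in> V" "\<rho> ^ n \<le> transition s n l j" using assms by (auto simp: reached_def)
  have "\<rho> * \<rho> ^ n \<le> w (s + n) i l * transition s n l j"
    using l \<rho>_pos assms by (intro mult_mono) (auto intro: nonneg)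
  also have "\<dots> \<le> (\<Sum>l\<in>V. w (s + n) i l * transition s n l j)"
    using l assms finite_V
    by (intro member_le_sum) (auto intro!: mult_nonneg_nonneg nonneg transition_nonneg)
  finally show ?thesis using assms by (simp add: reached_def)
qed

text \<open>An agent once reached stays reached, since its self-weight is at least
  \<open>\<rho>\<close>.\<close>

lemma reached_mono: "j \<in> V \<Longrightarrow> reached s n j \<subseteq> reached s (n + h) j"
proof (induction h)
  case (Suc h)
  have "i \<in> reached s (Suc (n + h)) j" if "i \<in> reached s (n + h) j" for i
    using that Suc.prems reached_Suc diag by (auto simp: reached_def intro: reached_Suc)
  then show ?case using Suc by auto
qed simp

text \<open>Unless all agents are reached already, \<open>crossing\<close> supplies within each
  window a new agent listening to a reached one, so every window adds at least one member.\<close>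

lemma reached_grows:
  assumes "j \<in> V"
  shows "reached s ((q + 1) * t) j = V \<or> t < card (reached s ((q + 1) * t) j)"
proof (induction t)
  case 0
  then show ?case using assms finite_V by (auto simp: reached_def card_gt_0_iff)
next
  case (Suc t)
  let ?n = "(q + 1) * t"
  let ?A = "reached s ?n j" and ?B = "reached s (?n + (q + 1)) j"
  have n: "(q + 1) * Suc t = ?n + (q + 1)" by simp
  have AB: "?A \<subseteq> ?B" using reached_mono assms by blast
  have BV: "?B \<subseteq> V" by (auto simp: reached_def)
  show ?case
  proof (cases "?A = V")
    case True
    then show ?thesis using AB BV unfolding n by blast
  next
    case False
    have "j \<in> ?A"
      using reached_mono[OF assms, of s 0 ?n] assms by (auto simp: reached_def)
    then obtain h i l where h: "h \<in> {1..q}" and i: "i \<in> V - ?A" and l: "l \<in> ?A"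
      and wl: "\<rho> \<le> w (s + ?n + h) i l"
      using crossing[of ?A "s + ?n"] False AB BV by blast
    have "l \<in> reached s (?n + h) j" using l reached_mono[OF assms] by blast
    then have "i \<in> reached s (Suc (?n + h)) j"
      using i assms wl by (intro reached_Suc) (auto simp: add.assoc)
    \<comment> \<open>The link at offset \<open>h\<close>, at most \<open>q\<close>, is used in the
      step from \<open>?n + h\<close> to \<open>?n + h + 1\<close>, hence windows of length
      \<open>q + 1\<close>. The remaining \<open>q - h\<close> steps only preserve
      membership.\<close>
    moreover have eq: "Suc (?n + h) + (q - h) = ?n + (q + 1)" using h by simp
    ultimately have "i \<in> ?B"
      using reached_mono[OF assms, of s "Suc (?n + h)" "q - h"] unfolding eq by blast
    then have "card ?A < card ?B"
      using AB BV i finite_V by (intro psubset_card_mono) (auto intro: finite_subset)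
    then show ?thesis using Suc.IH False unfolding n by linarith
  qed
qed

definition period :: nat where
  "period = (q + 1) * card V"

text \<open>After \<open>card V\<close> windows the cardinality alternative of
  \<open>reached_grows\<close> would exceed \<open>card V\<close>, so every agent is
  reached.\<close>

lemma transition_lower_bound:
  assumes "i \<in> V" "j \<in> V"
  shows "\<rho> ^ period \<le> transition s period i j"
proof -
  have "card (reached s period j) \<le> card V"
    using finite_V by (intro card_mono) (auto simp: reached_def)
  then have "reached s period j = V" using reached_grows[OF assms(2), of s "card V"] by (simp add: period_def)
  then show ?thesis using assms by (auto simp: reached_def)
qed

text \<open>
  Couple rows \<open>i\<close> and \<open>j\<close> independently: the pair \<open>(i, i)\<close> has mass at least
  \<open>(\<rho> ^ period)\<^sup>2\<close> and contributes nothing to the difference.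
\<close>

lemma transition_contracts:
  fixes z :: "'v \<Rightarrow> 'a::real_normed_vector"
  assumes D: "\<And>a b. a \<in> V \<Longrightarrow> b \<in> V \<Longrightarrow> norm (z a - z b) \<le> D" and i: "i \<in> V" and j: "j \<in> V"
  shows "norm ((\<Sum>a\<in>V. transition s period i a *\<^sub>R z a) - (\<Sum>a\<in>V. transition s period j a *\<^sub>R z a))
    \<le> (1 - (\<rho> ^ period)\<^sup>2) * D"
proof -
  let ?p = "transition s period"
  have D0: "0 \<le> D" using D[OF i i] by simp
  have coupling: "(\<Sum>a\<in>V. \<Sum>b\<in>V. ?p i a * ?p j b) = 1"
    using transition_row_sum i j by (simp add: sum_product[symmetric])
  \<comment> \<open>Both marginals of the coupling have mass one, so the double sum collapses to the
    difference of the two row averages.\<close>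
  have "(\<Sum>a\<in>V. \<Sum>b\<in>V. (?p i a * ?p j b) *\<^sub>R (z a - z b))
      = (\<Sum>a\<in>V. \<Sum>b\<in>V. ?p j b *\<^sub>R ?p i a *\<^sub>R z a) - (\<Sum>a\<in>V. \<Sum>b\<in>V. ?p i a *\<^sub>R ?p j b *\<^sub>R z b)"
    by (simp add: scaleR_diff_right sum_subtractf mult.commute)
  also have "(\<Sum>a\<in>V. \<Sum>b\<in>V. ?p j b *\<^sub>R ?p i a *\<^sub>R z a) = (\<Sum>a\<in>V. ?p i a *\<^sub>R z a)"
    using transition_row_sum[OF j, of s period] by (simp add: scaleR_left.sum[symmetric] del: scaleR_scaleR)
  also have "(\<Sum>a\<in>V. \<Sum>b\<in>V. ?p i a *\<^sub>R ?p j b *\<^sub>R z b) = (\<Sum>b\<in>V. ?p j b *\<^sub>R z b)"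
    using transition_row_sum[OF i, of s period]
    by (simp add: scaleR_left.sum[symmetric] scaleR_sum_right[symmetric] del: scaleR_scaleR)
  finally have "norm ((\<Sum>a\<in>V. ?p i a *\<^sub>R z a) - (\<Sum>b\<in>V. ?p j b *\<^sub>R z b))
      = norm (\<Sum>a\<in>V. \<Sum>b\<in>V. (?p i a * ?p j b) *\<^sub>R (z a - z b))" by simp
  also have "\<dots> \<le> (\<Sum>a\<in>V. \<Sum>b\<in>V. norm ((?p i a * ?p j b) *\<^sub>R (z a - z b)))"
    by (intro sum_norm_le norm_sum)
  also have "\<dots> \<le> (\<Sum>a\<in>V. \<Sum>b\<in>V. ?p i a * ?p j b * D - (if b = a then ?p i a * ?p j a * D else 0))"
  proof (intro sum_mono)
    fix a b assume ab: "a \<in> V" "b \<in> V"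
    then show "norm ((?p i a * ?p j b) *\<^sub>R (z a - z b))
        \<le> ?p i a * ?p j b * D - (if b = a then ?p i a * ?p j a * D else 0)"
      using D[OF ab] transition_nonneg i j by (auto intro!: mult_left_mono)
  qed
  also have "\<dots> = (\<Sum>a\<in>V. \<Sum>b\<in>V. ?p i a * ?p j b) * D - (\<Sum>a\<in>V. ?p i a * ?p j a * D)"
    using finite_V by (simp add: sum_subtractf sum_distrib_right)
  also have "\<dots> = D - (\<Sum>a\<in>V. ?p i a * ?p j a * D)"
    by (simp add: coupling)
  finally have "norm ((\<Sum>a\<in>V. ?p i a *\<^sub>R z a) - (\<Sum>b\<in>V. ?p j b *\<^sub>R z b))
      \<le> D - (\<Sum>a\<in>V. ?p i a * ?p j a * D)" .
  moreover have "?p i i * ?p j i * D \<le> (\<Sum>a\<in>V. ?p i a * ?p j a * D)"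
    using finite_V i j D0 transition_nonneg by (intro member_le_sum) auto
  moreover have "(\<rho> ^ period)\<^sup>2 * D \<le> ?p i i * ?p j i * D"
    unfolding power2_eq_square using D0 \<rho>_pos i j transition_lower_bound transition_nonneg
    by (intro mult_right_mono mult_mono) auto
  ultimately show ?thesis unfolding left_diff_distrib mult_1_left by linarith
qed

text \<open>Errors add up without amplification, because later steps only average them with
  nonnegative weights summing to one.\<close>

lemma transition_perturbation:
  fixes z :: "nat \<Rightarrow> 'v \<Rightarrow> 'a::real_normed_vector"
  assumes step: "\<And>k i. i \<in> V \<Longrightarrow> norm (z (Suc k) i - (\<Sum>j\<in>V. w k i j *\<^sub>R z k j)) \<le> \<epsilon> k"
    and "i \<in> V"
  shows "norm (z (s + n) i - (\<Sum>j\<in>V. transition s n i j *\<^sub>R z s j)) \<le> (\<Sum>l<n. \<epsilon> (s + l))"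
  using assms(2)
proof (induction n arbitrary: i)
  case 0
  have "(\<Sum>j\<in>V. transition s 0 i j *\<^sub>R z s j) = (\<Sum>j\<in>V. if i = j then z s j else 0)"
    by (intro sum.cong) auto
  then show ?case using 0 finite_V by simp
next
  case (Suc n)
  let ?v = "\<lambda>l. \<Sum>j\<in>V. transition s n l j *\<^sub>R z s j"
  have "(\<Sum>j\<in>V. transition s (Suc n) i j *\<^sub>R z s j) = (\<Sum>l\<in>V. w (s + n) i l *\<^sub>R ?v l)"
    by (simp add: scaleR_sum_left scaleR_sum_right) (rule sum.swap)
  \<comment> \<open>The error splits into the one made in the newest step and the average of the
    errors inherited from step \<open>n\<close>.\<close>
  then have eq: "z (s + Suc n) i - (\<Sum>j\<in>V. transition s (Suc n) i j *\<^sub>R z s j)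
      = (z (Suc (s + n)) i - (\<Sum>l\<in>V. w (s + n) i l *\<^sub>R z (s + n) l))
        + (\<Sum>l\<in>V. w (s + n) i l *\<^sub>R (z (s + n) l - ?v l))"
    by (simp add: scaleR_diff_right sum_subtractf)
  have "norm (z (s + Suc n) i - (\<Sum>j\<in>V. transition s (Suc n) i j *\<^sub>R z s j))
      \<le> \<epsilon> (s + n) + (\<Sum>l\<in>V. w (s + n) i l * (\<Sum>l<n. \<epsilon> (s + l)))"
    unfolding eq
  proof (intro norm_triangle_mono step Suc.prems sum_norm_le)
    fix l assume l: "l \<in> V"
    then show "norm (w (s + n) i l *\<^sub>R (z (s + n) l - ?v l)) \<le> w (s + n) i l * (\<Sum>l<n. \<epsilon> (s + l))"
      using nonneg[OF Suc.prems l] Suc.IH[OF l] by (simp add: mult_left_mono)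
  qed
  also have "\<dots> = (\<Sum>l<Suc n. \<epsilon> (s + l))"
    unfolding sum_distrib_right[symmetric] row_sum[OF Suc.prems] by simp
  finally show ?case .
qed

text \<open>The deterministic core: consensus for any averaging scheme with square summable errors,
  whatever produces the errors.\<close>

lemma square_summable_diameter:
  fixes z :: "nat \<Rightarrow> 'v \<Rightarrow> 'a::real_normed_vector"
  assumes V: "V \<noteq> {}"
    and step: "\<And>k i. i \<in> V \<Longrightarrow> norm (z (Suc k) i - (\<Sum>j\<in>V. w k i j *\<^sub>R z k j)) \<le> \<epsilon> k"
    and \<epsilon>: "summable (\<lambda>k. (\<epsilon> k)\<^sup>2)"
  obtains D where "summable (\<lambda>k. (D k)\<^sup>2)"
    "\<And>k i j. i \<in> V \<Longrightarrow> j \<in> V \<Longrightarrow> norm (z k i - z k j) \<le> D k"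
proof -
  define D where "D k = Max ((\<lambda>(i, j). norm (z k i - z k j)) ` (V \<times> V))" for k
  define c where "c = 1 - (\<rho> ^ period)\<^sup>2"
  \<comment> \<open>The factor 2 accounts for the errors of both agents in a pair.\<close>
  define h where "h k = 2 * (\<Sum>l<period. \<epsilon> (k + l))" for k
  have D: "norm (z k i - z k j) \<le> D k" if "i \<in> V" "j \<in> V" for k i j
    unfolding D_def using that finite_V by (intro Max_ge) auto
  have D0: "0 \<le> D k" for k
    using V D[where k = k] by (metis all_not_in_conv norm_ge_zero order_trans)
  have "0 \<le> \<epsilon> k" for k
    using V step[where k = k] by (metis all_not_in_conv norm_ge_zero order_trans)
  then have h0: "0 \<le> h k" for k
    by (simp add: h_def sum_nonneg)
  \<comment> \<open>\<open>\<rho> ^ period\<close> is at most one, being a lower bound for an entry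
    of a nonnegative row with sum one.\<close>
  have c: "0 \<le> c" "c < 1"
  proof -
    obtain i where i: "i \<in> V" using V by blast
    have "\<rho> ^ period \<le> transition 0 period i i" using i by (intro transition_lower_bound)
    also have "\<dots> \<le> (\<Sum>j\<in>V. transition 0 period i j)"
      using i finite_V transition_nonneg by (intro member_le_sum) auto
    also have "\<dots> = 1" by (rule transition_row_sum[OF i])
    finally have "(\<rho> ^ period)\<^sup>2 \<le> 1" using \<rho>_pos by (intro power_le_one[of "\<rho> ^ period" 2]) auto
    then show "0 \<le> c" by (simp add: c_def)
    show "c < 1" using \<rho>_pos by (simp add: c_def)
  qed
  have rec: "D (k + period) \<le> c * D k + h k" for k
  proof -
    let ?v = "\<lambda>i. \<Sum>a\<in>V. transition k period i a *\<^sub>R z k a"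
    have "norm (z (k + period) i - z (k + period) j) \<le> c * D k + h k" if ij: "i \<in> V" "j \<in> V" for i j
    proof -
      have "norm (?v i - ?v j) \<le> c * D k"
        unfolding c_def by (rule transition_contracts[OF D ij])
      moreover have "norm (z (k + period) i - ?v i) \<le> h k / 2" "norm (z (k + period) j - ?v j) \<le> h k / 2"
        using transition_perturbation[of z \<epsilon>, OF step] ij by (auto simp: h_def)
      moreover have "norm (z (k + period) i - z (k + period) j)
          \<le> norm (z (k + period) i - ?v i) + norm (?v i - ?v j) + norm (z (k + period) j - ?v j)"
        using dist_triangle3[of "z (k + period) i" "z (k + period) j" "?v i"]
          dist_triangle3[of "?v i" "z (k + period) j" "?v j"]
        by (simp add: dist_norm norm_minus_commute)
      ultimately show ?thesis by linarith
    qed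
    then show ?thesis
      unfolding D_def[of "k + period"] using V finite_V by (subst Max_le_iff) auto
  qed
  have "summable (\<lambda>k. (D k)\<^sup>2)"
  proof (rule summable_contractive_recursion)
    show "(D (k + period))\<^sup>2 \<le> c * (D k)\<^sup>2 + (h k)\<^sup>2 / (1 - c)" for k
      using power_mono[OF rec D0, of k 2] power2_add_le_contraction[OF c] by (rule order_trans)
    \<comment> \<open>Cauchy-Schwarz over the \<open>period\<close> summands; the 4 is the square of
      the factor in \<open>h\<close>.\<close>
    have bound: "(h k)\<^sup>2 \<le> 4 * real period * (\<Sum>l<period. (\<epsilon> (k + l))\<^sup>2)" for k
      using sum_squared_le_sum_of_squares[of "\<lambda>l. \<epsilon> (k + l)" "{..<period}"]
      by (simp add: h_def power_mult_distrib mult.commute)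
    have "summable (\<lambda>k. 4 * real period * (\<Sum>l<period. (\<epsilon> (k + l))\<^sup>2))"
      using \<epsilon> by (intro summable_mult summable_sum) (rule summable_ignore_initial_segment[of "\<lambda>k. (\<epsilon> k)\<^sup>2"])
    then have "summable (\<lambda>k. (h k)\<^sup>2)"
      by (rule summable_comparison_test'[where N = 0]) (use bound in simp)
    then show "summable (\<lambda>k. (h k)\<^sup>2 / (1 - c))" by (rule summable_divide)
  qed (use c in auto)
  then show ?thesis using that D by blast
qed

end

section \<open>The iteration on one sample path\<close>

theorem lemma5:
  fixes m q :: nat
    and X :: "(real ^ 'd) set" and r :: real
    and P :: "nat \<Rightarrow> 'b measure"
    and J :: "nat \<Rightarrow> real ^ 'd \<Rightarrow> 'b \<Rightarrow> real"
    and \<alpha> L U :: "nat \<Rightarrow> real"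
    and E :: "nat \<Rightarrow> (nat \<times> nat) set"
    and w :: "nat \<Rightarrow> nat \<Rightarrow> nat \<Rightarrow> real" and \<rho> :: real
    and \<delta> :: "nat \<Rightarrow> real" and \<delta>max :: real and X\<delta> :: "(real ^ 'd) set"
    and \<eta> :: "nat \<Rightarrow> real" and s :: "nat \<Rightarrow> nat \<Rightarrow> nat"
    and M :: "'w measure"
    and u x y yhat g :: "nat \<Rightarrow> nat \<Rightarrow> 'w \<Rightarrow> real ^ 'd"
    and \<xi> :: "nat \<Rightarrow> nat \<Rightarrow> nat \<Rightarrow> 'w \<Rightarrow> 'b"
    and C :: "nat \<Rightarrow> nat \<Rightarrow> 'w \<Rightarrow> real"
    and xbar :: "nat \<Rightarrow> 'w \<Rightarrow> real ^ 'd"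
  assumes m: "1 \<le> m"
    \<comment> \<open>feasible set\<close>
    and X: "X \<noteq> {}" "compact X" "convex X"
    and r: "0 < r" "cball 0 r \<subseteq> X"
    \<comment> \<open>distributions, risk levels and losses\<close>
    and P: "\<And>i. i \<in> {1..m} \<Longrightarrow> prob_space (P i)"
    and J_meas: "\<And>i z. i \<in> {1..m} \<Longrightarrow> z \<in> X \<Longrightarrow> J i z \<in> borel_measurable (P i)"
    and \<alpha>: "\<And>i. i \<in> {1..m} \<Longrightarrow> 0 < \<alpha> i \<and> \<alpha> i < 1"
    and L1_lipschitz: "\<And>i e. i \<in> {1..m} \<Longrightarrow> e \<in> space (P i) \<Longrightarrow>
          lipschitz_on (L i) X (\<lambda>z. J i z e)"
    and L1_pos: "\<And>i. i \<in> {1..m} \<Longrightarrow> 0 < U i"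
    and L1_bounded: "\<And>i z e. i \<in> {1..m} \<Longrightarrow> z \<in> X \<Longrightarrow> e \<in> space (P i) \<Longrightarrow> \<bar>J i z e\<bar> \<le> U i"
    and L2: "\<And>i e. i \<in> {1..m} \<Longrightarrow> e \<in> space (P i) \<Longrightarrow> convex_on X (\<lambda>z. J i z e)"
    \<comment> \<open>communication graphs and weights\<close>
    and graph: "\<And>k. pair_pseudo_graph (graph_on m (E k))"
    and G1: "1 \<le> q" "\<And>k. Digraph_Component.connected (with_proj (graph_on m (\<Union>l\<in>{1..q}. E (k + l))))"
    and G2_stochastic: "\<And>k. doubly_stochastic m (w k)"
    and G2_zero: "\<And>k i j. i \<in> {1..m} \<Longrightarrow> j \<in> {1..m} \<Longrightarrow> j \<notin> nbhd (E k) i \<Longrightarrow> w k i j = 0"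
    and G2_diag: "\<And>k i. i \<in> {1..m} \<Longrightarrow> 0 < w k i i"
    and G2_lower: "0 < \<rho>" "\<And>k i j. i \<in> {1..m} \<Longrightarrow> j \<in> nbhd (E k) i \<Longrightarrow> \<rho> \<le> w k i j"
    \<comment> \<open>parameters of the iteration\<close>
    and \<delta>: "\<And>i. i \<in> {1..m} \<Longrightarrow> 0 < \<delta> i"
    and \<delta>max: "\<delta>max = Max (\<delta> ` {1..m})" "\<delta>max < r"
    and X\<delta>: "X\<delta> = shrink (\<delta>max / r) X"
    and \<eta>: "\<And>k. 0 < \<eta> k"
    and s: "\<And>k i. i \<in> {1..m} \<Longrightarrow> 1 \<le> s k i"
    \<comment> \<open>the iteration\<close>
    and x0: "\<And>i \<omega>. i \<in> {1..m} \<Longrightarrow> \<omega> \<in> space M \<Longrightarrow> x 0 i \<omega> \<in> X\<delta>"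
    and y: "\<And>k i \<omega>. i \<in> {1..m} \<Longrightarrow> \<omega> \<in> space M \<Longrightarrow>
          y k i \<omega> = (\<Sum>j\<in>nbhd (E k) i. w k i j *\<^sub>R x k j \<omega>)"
    and yhat: "\<And>k i \<omega>. i \<in> {1..m} \<Longrightarrow> \<omega> \<in> space M \<Longrightarrow>
          yhat k i \<omega> = y k i \<omega> + \<delta> i *\<^sub>R u k i \<omega>"
    and C: "\<And>k i \<omega>. i \<in> {1..m} \<Longrightarrow> \<omega> \<in> space M \<Longrightarrow>
          C k i \<omega> = empirical_cvar (\<alpha> i) (s k i) (\<lambda>j. J i (yhat k i \<omega>) (\<xi> k i j \<omega>))"
    and g: "\<And>k i \<omega>. i \<in> {1..m} \<Longrightarrow> \<omega> \<in> space M \<Longrightarrow>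
          g k i \<omega> = (real CARD('d) / \<delta> i * C k i \<omega>) *\<^sub>R u k i \<omega>"
    and x_step: "\<And>k i \<omega>. i \<in> {1..m} \<Longrightarrow> \<omega> \<in> space M \<Longrightarrow>
          x (Suc k) i \<omega> = closest_point X\<delta> (y k i \<omega> - \<eta> k *\<^sub>R g k i \<omega>)"
    \<comment> \<open>randomness\<close>
    and M: "prob_space M"
    and x0_meas: "\<And>i. i \<in> {1..m} \<Longrightarrow> x 0 i \<in> borel_measurable M"
    and u_meas: "\<And>k i. i \<in> {1..m} \<Longrightarrow> u k i \<in> borel_measurable M"
    and u_sphere: "\<And>k i \<omega>. i \<in> {1..m} \<Longrightarrow> \<omega> \<in> space M \<Longrightarrow> u k i \<omega> \<in> sphere 0 1"
    and u_uniform: "\<And>k A. (\<And>i. i \<in> {1..m} \<Longrightarrow> A i \<in> sets borel) \<Longrightarrow>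
          AE \<omega> in M. real_cond_exp M (history M m P s x u \<xi> k)
              (indicator {\<omega>' \<in> space M. \<forall>i\<in>{1..m}. u k i \<omega>' \<in> A i}) \<omega>
            = (\<Prod>i\<in>{1..m}. measure uniform_sphere (A i))"
    and \<xi>_iid: "\<And>i. i \<in> {1..m} \<Longrightarrow>
          prob_space.indep_vars M (\<lambda>_. P i) (\<lambda>(k, j). \<xi> k i j) {(k, j). j \<in> {1..s k i}}"
        "\<And>k i j. i \<in> {1..m} \<Longrightarrow> j \<in> {1..s k i} \<Longrightarrow> distr M (P i) (\<xi> k i j) = P i"
    and \<xi>_indep: "\<And>k i. i \<in> {1..m} \<Longrightarrow>
          prob_space.indep_set M
            (sigma_sets (space M)
              (rv_events M (\<lambda>(l, j). \<xi> l i j) (\<lambda>_. P i) {(l, j). k \<le> l \<and> j \<in> {1..s l i}}))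
            (sigma_sets (space M)
              (rv_events M (\<lambda>(l, h). u l h) (\<lambda>_. borel) (UNIV \<times> {1..m}) \<union>
               rv_events M (\<lambda>(l, h). x l h) (\<lambda>_. borel) ({..k} \<times> {1..m})))"
    \<comment> \<open>network average and step-size conditions\<close>
    and xbar: "\<And>k \<omega>. \<omega> \<in> space M \<Longrightarrow> xbar k \<omega> = (1 / real m) *\<^sub>R (\<Sum>i\<in>{1..m}. x k i \<omega>)"
    and \<eta>_sum: "filterlim (\<lambda>n. \<Sum>k<n. \<eta> k) at_top sequentially"
    and \<eta>_sq: "summable (\<lambda>k. (\<eta> k)\<^sup>2)"
  shows "(\<forall>i\<in>{1..m}. \<forall>\<omega>\<in>space M. summable (\<lambda>k. \<eta> k * norm (xbar k \<omega> - x k i \<omega>))) \<and>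
         (\<forall>i\<in>{1..m}. AE \<omega> in M. (\<lambda>k. norm (xbar (Suc k) \<omega> - x (Suc k) i \<omega>)) \<longlonglongrightarrow> 0)"
proof -
  interpret M: prob_space M by (rule M)
  have ne: "{1..m} \<noteq> {}" using m by auto
  have E_sub: "E k \<subseteq> {1..m} \<times> {1..m}" and E_sym: "sym (E k)" for k
  proof -
    interpret pair_pseudo_graph "graph_on m (E k)" by (rule graph)
    show "E k \<subseteq> {1..m} \<times> {1..m}"
      using arc_fst_in_verts arc_snd_in_verts by (fastforce simp: graph_on_def)
    show "sym (E k)"
      using sym_arcs by (auto simp: symmetric_def graph_on_def)
  qed
  interpret averaging_weights "{1..m}" w \<rho> q
  proof
    fix k S assume S: "S \<subseteq> {1..m}" "S \<noteq> {}" "S \<noteq> {1..m}"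
    have "sym (\<Union>l\<in>{1..q}. E (k + l))"
      using E_sym by (intro sym_UNION) auto
    moreover have "(\<Union>l\<in>{1..q}. E (k + l)) \<subseteq> {1..m} \<times> {1..m}"
      using E_sub by blast
    ultimately obtain i j where "i \<in> {1..m} - S" "j \<in> S" "(i, j) \<in> (\<Union>l\<in>{1..q}. E (k + l))"
      using connected_graph_on_crossing[OF G1(2)] S by metis
    \<comment> \<open>An arc of the union lies in some \<open>E (k + h)\<close>, where
      \<open>G2_lower\<close> bounds its weight from below.\<close>
    then show "\<exists>h\<in>{1..q}. \<exists>i\<in>{1..m} - S. \<exists>j\<in>S. \<rho> \<le> w (k + h) i j"
      using G2_lower(2) by (fastforce simp: nbhd_def)
  qed (use G2_stochastic G2_lower in \<open>auto simp: doubly_stochastic_def nbhd_def\<close>)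

  have \<delta>_le: "\<delta> i \<le> \<delta>max" if "i \<in> {1..m}" for i
    using that by (auto simp: \<delta>max(1))
  have \<delta>max_pos: "0 < \<delta>max"
    using \<delta>[of 1] \<delta>_le[of 1] m by simp
  have c1: "\<delta>max / r < 1" using r(1) \<delta>max(2) by simp
  have X\<delta>_image: "X\<delta> = (\<lambda>z. (1 - \<delta>max / r) *\<^sub>R z) ` X"
    unfolding X\<delta> by (rule shrink_eq_image[OF c1])
  have X\<delta>_ne: "X\<delta> \<noteq> {}" and X\<delta>_closed: "closed X\<delta>" and X\<delta>_convex: "convex X\<delta>"
    unfolding X\<delta>_image using X
    by (auto intro: compact_imp_closed compact_scaling convex_scaling)

  \<comment> \<open>One bound on the gradient estimates for all agents: each summand bounds one
    agent's estimate, and all are nonnegative.\<close>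
  define G where "G = (\<Sum>i=1..m. real CARD('d) / \<delta> i * U i)"

  have path: "(summable (\<lambda>k. \<eta> k * norm (xbar k \<omega> - x k i \<omega>))) \<and>
      (\<lambda>k. norm (xbar k \<omega> - x k i \<omega>)) \<longlonglongrightarrow> 0"
    if \<omega>: "\<omega> \<in> space M" and i: "i \<in> {1..m}" for \<omega> i
  proof -
    have y_all: "y k i \<omega> = (\<Sum>j\<in>{1..m}. w k i j *\<^sub>R x k j \<omega>)" if i: "i \<in> {1..m}" for k i
      unfolding y[OF i \<omega>] using i E_sub[of k] G2_zero
      by (intro sum.mono_neutral_left) (auto simp: nbhd_def)
    have x_in: "x k i \<omega> \<in> X\<delta>" if "i \<in> {1..m}" for k i
      using that X\<delta>_closed X\<delta>_ne by (cases k) (auto simp: x0 \<omega> x_step closest_point_in_set)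
    have y_in: "y k i \<omega> \<in> X\<delta>" if i: "i \<in> {1..m}" for k i
      unfolding y_all[OF i] using i X\<delta>_convex x_in nonneg row_sum by (intro convex_sum) auto
    have u_norm: "norm (u k i \<omega>) = 1" if "i \<in> {1..m}" for k i
      using u_sphere[OF that \<omega>] by simp
    \<comment> \<open>The loss bound is available only on \<open>X\<close>, so the query points must
      lie there.\<close>
    have yhat_in: "yhat k i \<omega> \<in> X" if i: "i \<in> {1..m}" for k i
      unfolding yhat[OF i \<omega>] using y_in[OF i] \<delta>[OF i] \<delta>_le[OF i] u_norm[OF i]
      by (intro add_mem_of_shrink[OF X(3) r \<delta>max_pos \<delta>max(2)]) (auto simp: X\<delta>)
    have \<xi>_in: "\<xi> k i j \<omega> \<in> space (P i)" if "i \<in> {1..m}" "j \<in> {1..s k i}" for k i j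
    proof -
      have "\<xi> k i j \<in> measurable M (P i)"
        using \<xi>_iid(1)[OF that(1)] that(2) unfolding M.indep_vars_def by fastforce
      then show ?thesis using \<omega> by (rule measurable_space)
    qed
    have g_le: "norm (g k i \<omega>) \<le> G" if i: "i \<in> {1..m}" for k i
    proof -
      have "\<bar>C k i \<omega>\<bar> \<le> U i"
        unfolding C[OF i \<omega>] using \<alpha>[OF i] s[OF i] L1_bounded[OF i yhat_in[OF i] \<xi>_in[OF i]]
        by (intro bounded_empirical_cvar) auto
      then have "real CARD('d) / \<delta> i * \<bar>C k i \<omega>\<bar> \<le> real CARD('d) / \<delta> i * U i"
        using \<delta>[OF i] by (intro mult_left_mono) auto
      moreover have "norm (g k i \<omega>) = real CARD('d) / \<delta> i * \<bar>C k i \<omega>\<bar>"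
        using \<delta>[OF i] u_norm[OF i] by (simp add: g[OF i \<omega>] abs_mult)
      moreover have "real CARD('d) / \<delta> i * U i \<le> G"
        unfolding G_def using i \<delta> L1_pos
        by (intro member_le_sum) (auto intro!: mult_nonneg_nonneg divide_nonneg_pos less_imp_le)
      ultimately show ?thesis by linarith
    qed
    have step: "norm (x (Suc k) i \<omega> - (\<Sum>j\<in>{1..m}. w k i j *\<^sub>R x k j \<omega>)) \<le> \<eta> k * G"
      if i: "i \<in> {1..m}" for k i
    proof -
      \<comment> \<open>As a convex combination of points of \<open>X\<delta>\<close>,
        \<open>y k i \<omega>\<close> is fixed by the projection, so nonexpansiveness leaves only
        the gradient step.\<close>
      have "dist (x (Suc k) i \<omega>) (y k i \<omega>)
          = dist (closest_point X\<delta> (y k i \<omega> - \<eta> k *\<^sub>R g k i \<omega>)) (closest_point X\<delta> (y k i \<omega>))"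
        using y_in[OF i] by (simp add: x_step[OF i \<omega>] closest_point_self)
      also have "\<dots> \<le> dist (y k i \<omega> - \<eta> k *\<^sub>R g k i \<omega>) (y k i \<omega>)"
        by (rule closest_point_lipschitz[OF X\<delta>_convex X\<delta>_closed X\<delta>_ne])
      also have "\<dots> \<le> \<eta> k * G"
        using g_le[OF i] \<eta>[of k] by (simp add: dist_norm mult_left_mono less_imp_le)
      finally show ?thesis unfolding y_all[OF i] dist_norm .
    qed
    have sq: "summable (\<lambda>k. (\<eta> k * G)\<^sup>2)"
      unfolding power_mult_distrib using \<eta>_sq by (rule summable_mult2)
    obtain D where D: "summable (\<lambda>k. (D k)\<^sup>2)"
      "\<And>k i j. i \<in> {1..m} \<Longrightarrow> j \<in> {1..m} \<Longrightarrow> norm (x k i \<omega> - x k j \<omega>) \<le> D k"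
      by (rule square_summable_diameter[where z = "\<lambda>k i. x k i \<omega>", OF ne step sq]) (assumption, rule that)
    have dev: "norm (xbar k \<omega> - x k i \<omega>) \<le> D k" for k
    proof -
      have "(\<Sum>j\<in>{1..m}. x k j \<omega> - x k i \<omega>) = (\<Sum>j\<in>{1..m}. x k j \<omega>) - real m *\<^sub>R x k i \<omega>"
        by (simp only: sum_subtractf sum_constant_scaleR) simp
      then have "xbar k \<omega> - x k i \<omega> = (1 / real m) *\<^sub>R (\<Sum>j\<in>{1..m}. x k j \<omega> - x k i \<omega>)"
        using m by (simp add: xbar[OF \<omega>] scaleR_diff_right)
      moreover have "norm (\<Sum>j\<in>{1..m}. x k j \<omega> - x k i \<omega>) \<le> real (card {1..m}) * D k"
        using D(2) i by (intro sum_norm_bound) auto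
      ultimately show ?thesis using m by (simp add: field_simps)
    qed
    have "summable (\<lambda>k. (\<eta> k)\<^sup>2 + (D k)\<^sup>2)"
      using \<eta>_sq D(1) by (rule summable_add)
    moreover have "norm (\<eta> k * norm (xbar k \<omega> - x k i \<omega>)) \<le> (\<eta> k)\<^sup>2 + (D k)\<^sup>2" for k
    proof -
      have D0: "0 \<le> D k" using dev[of k] norm_ge_zero order_trans by blast
      have "\<eta> k * norm (xbar k \<omega> - x k i \<omega>) \<le> \<eta> k * D k"
        using dev \<eta>[of k] by (intro mult_left_mono) auto
      also have "\<dots> \<le> 2 * \<eta> k * D k"
        using D0 \<eta>[of k] by simp
      also have "\<dots> \<le> (\<eta> k)\<^sup>2 + (D k)\<^sup>2"
        by (rule sum_squares_bound)
      finally show ?thesis using \<eta>[of k] by simp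
    qed
    ultimately have "summable (\<lambda>k. \<eta> k * norm (xbar k \<omega> - x k i \<omega>))"
      by (rule summable_comparison_test'[where N = 0])
    moreover have "(\<lambda>k. norm (xbar k \<omega> - x k i \<omega>)) \<longlonglongrightarrow> 0"
    proof (rule tendsto_sandwich[OF _ _ tendsto_const])
      \<comment> \<open>Square summability makes the squares tend to zero; taking roots gives the
        upper bound \<open>\<bar>D k\<bar>\<close> for the sandwich.\<close>
      have "(\<lambda>k. sqrt ((D k)\<^sup>2)) \<longlonglongrightarrow> sqrt 0"
        using D(1) by (intro tendsto_real_sqrt summable_LIMSEQ_zero)
      then show "(\<lambda>k. \<bar>D k\<bar>) \<longlonglongrightarrow> 0" by simp
    qed (use dev in \<open>auto intro!: always_eventually order_trans[OF _ abs_ge_self]\<close>)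
    ultimately show ?thesis by blast
  qed
  show ?thesis
  proof (intro conjI ballI AE_I2)
    show "summable (\<lambda>k. \<eta> k * norm (xbar k \<omega> - x k i \<omega>))"
      if "i \<in> {1..m}" "\<omega> \<in> space M" for i \<omega>
      using path that by blast
    show "(\<lambda>k. norm (xbar (Suc k) \<omega> - x (Suc k) i \<omega>)) \<longlonglongrightarrow> 0"
      if "i \<in> {1..m}" "\<omega> \<in> space M" for i \<omega>
      using path[OF that(2,1)] LIMSEQ_Suc by blast
  qed
qed

end
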